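(* Let $N\ge 2$ be an integer and $\alpha\in(0,1)$. For every $\lambda>0$ and every $f\in L^2(\mathbb{T},\mu)$, the functional $$\mathcal{J}(u)=\frac12\mathcal{E}_\alpha(u)+\frac{\lambda}{2}\|u\|_{L^2(\mathbb{T},\mu)}^2-\int_{\mathbb{T}}fu\,d\mu,\qquad u\in\mathcal{H}_\alpha(\mathbb{T}),$$ admits a unique minimizer in $\mathcal{H}_\alpha(\mathbb{T})$.
   Context: Let $D=\{2,3,\dots,N+1\}$ and $\mathbb{T}=[0,1]\cup D\subset\mathbb{R}$, with the positive finite Borel measure $\mu(A)=\int_{A\cap[0,1]}dx+\sum_{k=2}^{N+1}\delta_k(A)$, so that $\int_{\mathbb{T}} f\,d\mu=\int_0^1 f(x)\,dx+\sum_{k=2}^{N+1}f(k)$. A function $u:\mathbb{T}\to\mathbb{R}$ is written $u=(v,a_2,\dots,a_{N+1})$ with $v=u|_{[0,1]}$ and $a_k=u(k)$. The Gagliardo seminorm is $[v]_{H^\alpha(0,1)}^2=\int_0^1\int_0^1\frac{|v(x)-v(y)|^2}{|x-y|^{1+2\alpha}}\,dx\,dy$, and $H^\alpha(0,1)=\{v\in L^2(0,1):[v]_{H^\alpha(0,1)}<\infty\}$. The hybrid energy space is $\mathcal{H}_\alpha(\mathbb{T})=\{u=(v,a_2,\dots,a_{N+1}): v\in H^\alpha(0,1),\ a_k\in\mathbb{R}\}$ (functions identified when equal $\mu$-a.e.). The energy is $\mathcal{E}_\alpha(u)=\iint_{\mathbb{T}\times\mathbb{T}}\frac{|u(x)-u(y)|^2}{|x-y|^{1+2\alpha}}\,d\mu(x)\,d\mu(y)$,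 where the integrand is taken to be $0$ on the diagonal $x=y$. *)

theory Defs
  imports "HOL-Analysis.Analysis"
begin

definition hybrid_set :: "nat \<Rightarrow> real set" where
  "hybrid_set N = {0..1} \<union> real ` {2..N + 1}"

definition hybrid_measure :: "nat \<Rightarrow> real measure" where
  "hybrid_measure N = measure_of (hybrid_set N) (sets (restrict_space borel (hybrid_set N)))
     (\<lambda>A. emeasure lborel (A \<inter> {0..1}) + (\<Sum>k\<in>{2..N + 1}. indicator A (real k)))"

text \<open>Elements of \<open>L\<^sup>2\<close> spaces, and of the spaces built from them below, are functions;
  the identification of functions that agree almost everywhere is made explicit where it matters.\<close>

definition L2_space :: "'a measure \<Rightarrow> ('a \<Rightarrow> real) set" where
  "L2_space M = {f \<in> borel_measurable M. integrable M (\<lambda>x. (f x)\<^sup>2)}"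

definition L2_norm :: "'a measure \<Rightarrow> ('a \<Rightarrow> real) \<Rightarrow> real" where
  "L2_norm M f = sqrt (\<integral>x. (f x)\<^sup>2 \<partial>M)"

definition difference_quotient :: "real \<Rightarrow> (real \<Rightarrow> real) \<Rightarrow> real \<Rightarrow> real \<Rightarrow> real" where
  "difference_quotient \<alpha> u x y =
     (if x = y then 0 else \<bar>u x - u y\<bar>\<^sup>2 / \<bar>x - y\<bar> powr (1 + 2 * \<alpha>))"

abbreviation unit_measure :: "real measure" where
  "unit_measure \<equiv> restrict_space lborel {0<..<1}"

definition gagliardo_sq :: "real \<Rightarrow> (real \<Rightarrow> real) \<Rightarrow> ennreal" where
  "gagliardo_sq \<alpha> v =
     (\<integral>\<^sup>+x. (\<integral>\<^sup>+y. ennreal (difference_quotient \<alpha> v x y) \<partial>unit_measure) \<partial>unit_measure)"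

definition frac_sobolev :: "real \<Rightarrow> (real \<Rightarrow> real) set" where
  "frac_sobolev \<alpha> = {v \<in> L2_space unit_measure. gagliardo_sq \<alpha> v < \<infinity>}"

text \<open>A function \<open>u = (v, a\<^sub>2, \<dots>, a\<^sub>N\<^sub>+\<^sub>1)\<close> on the hybrid set is a function on the reals whose values
  off that set are irrelevant. The values \<open>a\<^sub>k\<close> are unrestricted: membership in \<open>frac_sobolev\<close>
  depends only on the values on the unit interval.\<close>

definition hybrid_space :: "nat \<Rightarrow> real \<Rightarrow> (real \<Rightarrow> real) set" where
  "hybrid_space N \<alpha> = {u \<in> borel_measurable (hybrid_measure N). u \<in> frac_sobolev \<alpha>}"

definition hybrid_energy :: "nat \<Rightarrow> real \<Rightarrow> (real \<Rightarrow> real) \<Rightarrow> ennreal" where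
  "hybrid_energy N \<alpha> u =
     (\<integral>\<^sup>+z. ennreal (difference_quotient \<alpha> u (fst z) (snd z))
        \<partial>(hybrid_measure N \<Otimes>\<^sub>M hybrid_measure N))"

text \<open>On \<open>hybrid_space N \<alpha>\<close> no term below takes a junk value: the energy is finite and
  \<open>u\<close> is square integrable (lemmas \<open>hybrid_energy_finite\<close> and \<open>hybrid_space_L2\<close>).\<close>

definition hybrid_functional ::
    "nat \<Rightarrow> real \<Rightarrow> real \<Rightarrow> (real \<Rightarrow> real) \<Rightarrow> (real \<Rightarrow> real) \<Rightarrow> real" where
  "hybrid_functional N \<alpha> l f u =
     1 / 2 * enn2real (hybrid_energy N \<alpha> u) + l / 2 * (L2_norm (hybrid_measure N) u)\<^sup>2
       - (\<integral>x. f x * u x \<partial>hybrid_measure N)"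

definition is_minimizer_on :: "('a \<Rightarrow> real) \<Rightarrow> 'a set \<Rightarrow> 'a \<Rightarrow> bool" where
  "is_minimizer_on J S u \<longleftrightarrow> u \<in> S \<and> (\<forall>w\<in>S. J u \<le> J w)"

lemma hybrid_set_borel [measurable]: "hybrid_set N \<in> sets borel"
  unfolding hybrid_set_def by (intro sets.Un) (auto intro: borel_closed finite_imp_closed)

lemma space_hybrid_measure [simp]: "space (hybrid_measure N) = hybrid_set N"
  and sets_hybrid_measure [measurable_cong]:
    "sets (hybrid_measure N) = sets (restrict_space borel (hybrid_set N))"
proof -
  have *: "sets (restrict_space borel (hybrid_set N)) \<subseteq> Pow (hybrid_set N)"
    using sets.space_closed[of "restrict_space borel (hybrid_set N)"] by (simp add: space_restrict_space)
  show "space (hybrid_measure N) = hybrid_set N"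
    unfolding hybrid_measure_def using * by (simp add: space_measure_of)
  show "sets (hybrid_measure N) = sets (restrict_space borel (hybrid_set N))"
    unfolding hybrid_measure_def using * sets.sigma_sets_eq[of "restrict_space borel (hybrid_set N)"]
    by (simp add: space_restrict_space)
qed

lemma emeasure_hybrid_measure:
  assumes "A \<in> sets (hybrid_measure N)"
  shows "emeasure (hybrid_measure N) A =
    emeasure lborel (A \<inter> {0..1}) + (\<Sum>k\<in>{2..N + 1}. indicator A (real k))"
proof (rule emeasure_measure_of[OF hybrid_measure_def])
  show "sets (restrict_space borel (hybrid_set N)) \<subseteq> Pow (hybrid_set N)"
    using sets.space_closed[of "restrict_space borel (hybrid_set N)"] by (simp add: space_restrict_space)
  show "A \<in> sets (hybrid_measure N)" by fact
  show "positive (sets (hybrid_measure N))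
     (\<lambda>A. emeasure lborel (A \<inter> {0..1}) + (\<Sum>k\<in>{2..N + 1}. indicator A (real k)))"
    by (simp add: positive_def)
  show "countably_additive (sets (hybrid_measure N))
     (\<lambda>A. emeasure lborel (A \<inter> {0..1}) + (\<Sum>k\<in>{2..N + 1}. indicator A (real k)))"
  proof (rule countably_additiveI)
    fix B :: "nat \<Rightarrow> real set"
    assume B: "range B \<subseteq> sets (hybrid_measure N)" and d: "disjoint_family B"
    have Bb: "B i \<in> sets borel" for i
      using B hybrid_set_borel[of N]
      by (auto simp: sets_hybrid_measure sets_restrict_space_iff image_subset_iff)
    have 1: "(\<Sum>i. emeasure lborel (B i \<inter> {0..1})) = emeasure lborel (\<Union>i. B i \<inter> {0..1})"
      by (rule suminf_emeasure) (use Bb d in \<open>auto simp: disjoint_family_on_def\<close>)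
    have 2: "(\<Sum>i. indicator (B i) x) = (indicator (\<Union>i. B i) x :: ennreal)" for x
      by (rule suminf_indicator[OF d])
    have "(\<Sum>i. emeasure lborel (B i \<inter> {0..1}) + (\<Sum>k\<in>{2..N + 1}. indicator (B i) (real k))) =
      (\<Sum>i. emeasure lborel (B i \<inter> {0..1})) + (\<Sum>i. \<Sum>k\<in>{2..N + 1}. indicator (B i) (real k))"
      by (rule suminf_add[symmetric]) (rule summableI)+
    also have "(\<Sum>i. \<Sum>k\<in>{2..N + 1}. indicator (B i) (real k)) =
      (\<Sum>k\<in>{2..N + 1}. \<Sum>i. indicator (B i) (real k) :: ennreal)"
      by (rule suminf_sum) (rule summableI)
    finally show "(\<Sum>i. emeasure lborel (B i \<inter> {0..1}) + (\<Sum>k\<in>{2..N + 1}. indicator (B i) (real k))) =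
      emeasure lborel ((\<Union>i. B i) \<inter> {0..1}) + (\<Sum>k\<in>{2..N + 1}. indicator (\<Union>i. B i) (real k))"
      unfolding 1 2 by (simp only: Int_UN_distrib2 UN_simps)
  qed
qed

lemma finite_measure_hybrid: "finite_measure (hybrid_measure N)"
proof
  have "hybrid_set N \<inter> {0..1} = {0..1}" by (auto simp: hybrid_set_def)
  then show "emeasure (hybrid_measure N) (space (hybrid_measure N)) \<noteq> \<infinity>"
    using sets.top[of "hybrid_measure N"]
    by (auto simp: emeasure_hybrid_measure ennreal_add_eq_top indicator_def simp del: sets.top)
qed

lemma nn_integral_hybrid:
  assumes "g \<in> borel_measurable (hybrid_measure N)"
  shows "(\<integral>\<^sup>+x. g x \<partial>hybrid_measure N) =
    (\<integral>\<^sup>+x. g x \<partial>unit_measure) + (\<Sum>k\<in>{2..N + 1}. g (real k))"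
proof -
  have sub: "{0<..<1} \<subseteq> hybrid_set N" "\<And>k. k \<in> {2..N + 1} \<Longrightarrow> real k \<in> hybrid_set N"
    by (auto simp: hybrid_set_def)
  have mono: "h \<in> borel_measurable unit_measure"
    if h: "h \<in> borel_measurable (hybrid_measure N)" for h :: "real \<Rightarrow> ennreal"
  proof -
    have "h \<in> borel_measurable (restrict_space borel (hybrid_set N))"
      using h by (simp add: measurable_cong_sets[OF sets_hybrid_measure refl])
    from measurable_restrict_mono[OF this sub(1)]
    show ?thesis by (simp add: measurable_cong_sets[OF sets_restrict_space_cong[OF sets_lborel] refl])
  qed
  show ?thesis using assms
  proof (induction rule: borel_measurable_induct)
    case (cong f g)
    have "(\<integral>\<^sup>+x. f x \<partial>unit_measure) = (\<integral>\<^sup>+x. g x \<partial>unit_measure)"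
      using cong(3) sub by (intro nn_integral_cong) (auto simp: space_restrict_space)
    moreover have "(\<integral>\<^sup>+x. f x \<partial>hybrid_measure N) = (\<integral>\<^sup>+x. g x \<partial>hybrid_measure N)"
      using cong(3) by (intro nn_integral_cong) auto
    moreover have "(\<Sum>k\<in>{2..N + 1}. f (real k)) = (\<Sum>k\<in>{2..N + 1}. g (real k))"
      using cong(3) sub(2) by (intro sum.cong) auto
    ultimately show ?case using cong by simp
  next
    case (set A)
    then have A: "A \<in> sets borel" by (auto simp: sets_hybrid_measure sets_restrict_space_iff)
    have AE: "AE x in lborel. x \<in> A \<inter> {0..1} \<longleftrightarrow> x \<in> A \<inter> {0<..<1::real}"
      using AE_lborel_singleton[of 0] AE_lborel_singleton[of 1] by eventually_elim auto
    have "(\<integral>\<^sup>+x. indicator A x \<partial>unit_measure) = (\<integral>\<^sup>+x. indicator (A \<inter> {0<..<1}) x \<partial>lborel)"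
      by (subst nn_integral_restrict_space) (auto intro!: nn_integral_cong simp: indicator_def)
    also have "\<dots> = emeasure lborel (A \<inter> {0<..<1})"
      using A by (intro nn_integral_indicator) auto
    also have "\<dots> = emeasure lborel (A \<inter> {0..1})"
      using AE A by (intro emeasure_eq_AE) auto
    finally show ?case using set by (simp add: emeasure_hybrid_measure)
  next
    case (mult u c)
    have "(\<integral>\<^sup>+x. c * u x \<partial>hybrid_measure N) = c * (\<integral>\<^sup>+x. u x \<partial>hybrid_measure N)"
      using mult by (intro nn_integral_cmult)
    moreover have "(\<integral>\<^sup>+x. c * u x \<partial>unit_measure) = c * (\<integral>\<^sup>+x. u x \<partial>unit_measure)"
      using mono mult by (intro nn_integral_cmult)
    ultimately show ?case by (simp only: mult distrib_left sum_distrib_left)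
  next
    case (add u v)
    have "(\<integral>\<^sup>+x. v x + u x \<partial>hybrid_measure N) =
        (\<integral>\<^sup>+x. v x \<partial>hybrid_measure N) + (\<integral>\<^sup>+x. u x \<partial>hybrid_measure N)"
      using add by (intro nn_integral_add)
    moreover have "(\<integral>\<^sup>+x. v x + u x \<partial>unit_measure) =
        (\<integral>\<^sup>+x. v x \<partial>unit_measure) + (\<integral>\<^sup>+x. u x \<partial>unit_measure)"
      using mono add by (intro nn_integral_add)
    ultimately show ?case by (simp only: add sum.distrib ac_simps)
  next
    case (seq U)
    have inc: "incseq (\<lambda>i. (\<integral>\<^sup>+x. U i x \<partial>unit_measure))"
      using seq(3) by (auto simp: incseq_def le_fun_def intro!: nn_integral_mono)
    have incs: "incseq (\<lambda>i. (\<Sum>k\<in>{2..N + 1}. U i (real k)))"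
      using seq(3) unfolding incseq_def le_fun_def by (intro allI impI sum_mono) blast
    have "(\<integral>\<^sup>+x. (SUP i. U i) x \<partial>hybrid_measure N) = (SUP i. (\<integral>\<^sup>+x. U i x \<partial>hybrid_measure N))"
      unfolding SUP_apply using seq by (intro nn_integral_monotone_convergence_SUP) auto
    also have "\<dots> = (SUP i. (\<integral>\<^sup>+x. U i x \<partial>unit_measure) + (\<Sum>k\<in>{2..N + 1}. U i (real k)))"
      using seq by simp
    also have "\<dots> = (SUP i. (\<integral>\<^sup>+x. U i x \<partial>unit_measure)) + (SUP i. \<Sum>k\<in>{2..N + 1}. U i (real k))"
      by (rule ennreal_SUP_add[OF inc incs])
    also have "(SUP i. (\<integral>\<^sup>+x. U i x \<partial>unit_measure)) = (\<integral>\<^sup>+x. (SUP i. U i) x \<partial>unit_measure)"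
      unfolding SUP_apply using seq(3) mono[OF seq(1)]
      by (intro nn_integral_monotone_convergence_SUP[symmetric])
    also have "(SUP i. \<Sum>k\<in>{2..N + 1}. U i (real k)) = (\<Sum>k\<in>{2..N + 1}. (SUP i. U i) (real k))"
      unfolding SUP_apply using seq(3)
      by (intro ennreal_SUP_sum) (auto simp: incseq_def le_fun_def)
    finally show ?case .
  qed
qed

lemma hybrid_space_L2:
  assumes "u \<in> hybrid_space N \<alpha>"
  shows "u \<in> L2_space (hybrid_measure N)"
proof -
  have [measurable]: "u \<in> borel_measurable (hybrid_measure N)"
    and i: "integrable unit_measure (\<lambda>x. (u x)\<^sup>2)"
    using assms by (auto simp: hybrid_space_def frac_sobolev_def L2_space_def)
  have "(\<integral>\<^sup>+x. ennreal ((u x)\<^sup>2) \<partial>hybrid_measure N) < \<infinity>"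
    using i by (subst nn_integral_hybrid) (auto simp: integrable_iff_bounded)
  then show ?thesis by (auto simp: L2_space_def integrable_iff_bounded)
qed

lemma borel_measurable_difference_quotient [measurable]:
  assumes [measurable]: "u \<in> borel_measurable (hybrid_measure N)"
  shows "(\<lambda>z. difference_quotient \<alpha> u (fst z) (snd z))
    \<in> borel_measurable (hybrid_measure N \<Otimes>\<^sub>M hybrid_measure N)"
proof -
  have [measurable]: "(\<lambda>x. x) \<in> borel_measurable (hybrid_measure N)"
    by (subst measurable_cong_sets[OF sets_hybrid_measure refl])
       (rule measurable_restrict_space1, simp)
  have [measurable]: "fst \<in> borel_measurable (hybrid_measure N \<Otimes>\<^sub>M hybrid_measure N)"
    "snd \<in> borel_measurable (hybrid_measure N \<Otimes>\<^sub>M hybrid_measure N)"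
    using measurable_compose[OF measurable_fst \<open>(\<lambda>x. x) \<in> borel_measurable (hybrid_measure N)\<close>]
      measurable_compose[OF measurable_snd \<open>(\<lambda>x. x) \<in> borel_measurable (hybrid_measure N)\<close>]
    by auto
  show ?thesis unfolding difference_quotient_def
    by measurable
qed

lemma hybrid_energy_finite:
  assumes u: "u \<in> hybrid_space N \<alpha>" and \<alpha>: "0 < \<alpha>"
  shows "hybrid_energy N \<alpha> u < \<infinity>"
proof -
  let ?M = "hybrid_measure N"
  let ?Q = "\<lambda>x y. ennreal (difference_quotient \<alpha> u x y)"
  let ?I = "\<lambda>x. indicator {..1::real} x :: ennreal"
  interpret finite_measure ?M by (rule finite_measure_hybrid)
  interpret P: pair_sigma_finite ?M ?M ..
  have um [measurable]: "u \<in> borel_measurable ?M"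
    and g: "gagliardo_sq \<alpha> u < \<infinity>"
    using u by (auto simp: hybrid_space_def frac_sobolev_def)
  have Im [measurable]: "?I \<in> borel_measurable ?M"
    by (subst measurable_cong_sets[OF sets_hybrid_measure refl])
       (rule measurable_restrict_space1, simp)
  have Q: "(\<lambda>z. ?Q (fst z) (snd z)) \<in> borel_measurable (?M \<Otimes>\<^sub>M ?M)"
    by measurable
  have Qx [measurable]: "(\<lambda>y. ?Q x y) \<in> borel_measurable ?M" if "x \<in> hybrid_set N" for x
    using measurable_compose[OF measurable_Pair1' Q, of x] that by simp
  have F [measurable]:
    "(\<lambda>z. ?I (fst z) * (?I (snd z) * ?Q (fst z) (snd z))) \<in> borel_measurable (?M \<Otimes>\<^sub>M ?M)"
    by measurable
  have cut: "(\<integral>\<^sup>+x. ?I x * h x \<partial>?M) = (\<integral>\<^sup>+x. h x \<partial>unit_measure)"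
    if [measurable]: "h \<in> borel_measurable ?M" for h
  proof -
    have "(\<integral>\<^sup>+x. ?I x * h x \<partial>?M) = (\<integral>\<^sup>+x. ?I x * h x \<partial>unit_measure) + 0"
      by (subst nn_integral_hybrid) auto
    also have "\<dots> = (\<integral>\<^sup>+x. h x \<partial>unit_measure)"
      by (auto intro!: nn_integral_cong simp: space_restrict_space indicator_def)
    finally show ?thesis .
  qed
  have Qi [measurable]: "(\<lambda>x. \<integral>\<^sup>+y. ?I y * ?Q x y \<partial>?M) \<in> borel_measurable ?M"
    by (rule borel_measurable_nn_integral) (simp add: split_beta')
  have "(\<integral>\<^sup>+z. ?I (fst z) * (?I (snd z) * ?Q (fst z) (snd z)) \<partial>(?M \<Otimes>\<^sub>M ?M))
      = (\<integral>\<^sup>+x. \<integral>\<^sup>+y. ?I x * (?I y * ?Q x y) \<partial>?M \<partial>?M)"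
    by (subst nn_integral_fst[OF F, symmetric]) simp
  also have "\<dots> = (\<integral>\<^sup>+x. ?I x * (\<integral>\<^sup>+y. ?I y * ?Q x y \<partial>?M) \<partial>?M)"
    by (intro nn_integral_cong nn_integral_cmult) auto
  also have "\<dots> = (\<integral>\<^sup>+x. (\<integral>\<^sup>+y. ?I y * ?Q x y \<partial>?M) \<partial>unit_measure)"
    by (rule cut[OF Qi])
  also have "\<dots> = gagliardo_sq \<alpha> u"
    unfolding gagliardo_sq_def
    by (intro nn_integral_cong cut Qx) (auto simp: space_restrict_space hybrid_set_def)
  finally have near: "(\<integral>\<^sup>+z. ?I (fst z) * (?I (snd z) * ?Q (fst z) (snd z)) \<partial>(?M \<Otimes>\<^sub>M ?M)) < \<infinity>"
    using g by simp
  have s: "(\<integral>\<^sup>+x. ennreal (2 * (u x)\<^sup>2) \<partial>?M) < \<infinity>"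
    using hybrid_space_L2[OF u] unfolding L2_space_def
    by (auto simp: integrable_iff_bounded ennreal_mult nn_integral_cmult ennreal_mult_less_top)
  have fin: "emeasure ?M (hybrid_set N) < top"
    by (simp add: less_top[symmetric])
  have far1: "(\<integral>\<^sup>+z. ennreal (2 * (u (fst z))\<^sup>2) \<partial>(?M \<Otimes>\<^sub>M ?M)) < \<infinity>"
    by (subst nn_integral_fst[symmetric])
       (use s in \<open>auto simp: nn_integral_multc ennreal_mult_less_top fin\<close>)
  have far2: "(\<integral>\<^sup>+z. ennreal (2 * (u (snd z))\<^sup>2) \<partial>(?M \<Otimes>\<^sub>M ?M)) < \<infinity>"
    by (subst nn_integral_fst[symmetric])
       (use s in \<open>auto simp: ennreal_mult_less_top fin\<close>)
  have pt: "?Q x y \<le> ?I x * (?I y * ?Q x y) + (ennreal (2 * (u x)\<^sup>2) + ennreal (2 * (u y)\<^sup>2))"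
    if xy: "x \<in> hybrid_set N" "y \<in> hybrid_set N" for x y
  proof (cases "x \<le> 1 \<and> y \<le> 1 \<or> x = y")
    case True
    then show ?thesis by (auto simp: difference_quotient_def add_increasing2)
  next
    case False
    have "1 \<le> \<bar>x - y\<bar>" using xy False unfolding hybrid_set_def by auto
    then have "1 \<le> \<bar>x - y\<bar> powr (1 + 2 * \<alpha>)" using \<alpha> by (intro ge_one_powr_ge_zero) auto
    then have "difference_quotient \<alpha> u x y \<le> \<bar>u x - u y\<bar>\<^sup>2"
      unfolding difference_quotient_def by (simp add: divide_le_eq mult_left_mono mult_le_cancel_left1)
    also have "\<dots> \<le> 2 * (u x)\<^sup>2 + 2 * (u y)\<^sup>2"
      using zero_le_power2[of "u x + u y"] by (simp add: power2_eq_square algebra_simps)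
    finally have "?Q x y \<le> ennreal (2 * (u x)\<^sup>2 + 2 * (u y)\<^sup>2)" by (rule ennreal_leI)
    then show ?thesis by (simp add: add_increasing)
  qed
  have "hybrid_energy N \<alpha> u \<le> (\<integral>\<^sup>+z. ?I (fst z) * (?I (snd z) * ?Q (fst z) (snd z)) +
      (ennreal (2 * (u (fst z))\<^sup>2) + ennreal (2 * (u (snd z))\<^sup>2)) \<partial>(?M \<Otimes>\<^sub>M ?M))"
    unfolding hybrid_energy_def by (intro nn_integral_mono pt) (auto simp: space_pair_measure)
  also have "\<dots> = (\<integral>\<^sup>+z. ?I (fst z) * (?I (snd z) * ?Q (fst z) (snd z)) \<partial>(?M \<Otimes>\<^sub>M ?M)) +
      ((\<integral>\<^sup>+z. ennreal (2 * (u (fst z))\<^sup>2) \<partial>(?M \<Otimes>\<^sub>M ?M)) +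
       (\<integral>\<^sup>+z. ennreal (2 * (u (snd z))\<^sup>2) \<partial>(?M \<Otimes>\<^sub>M ?M)))"
    by (subst nn_integral_add nn_integral_add; measurable)+
  also have "\<dots> < \<infinity>" using near far1 far2 by simp
  finally show ?thesis .
qed

end

theory Submission
  imports Defs
begin

text \<open>Completing the square turns the functional, up to an additive constant, into half of
  \<open>\<E>(u) + \<lambda> \<parallel>u - f / \<lambda>\<parallel>\<^sup>2\<close>, a sum of two nonnegative quadratic terms. By the parallelogram
  identity a minimizing sequence is Cauchy in \<open>L\<^sup>2\<close>, hence in \<open>L\<^sup>1\<close> because the measure is finite,
  so a subsequence converges almost everywhere. Fatou's lemma, applied to both terms, shows that the
  limit has finite energy and is a minimizer. The same identity gives uniqueness.\<close>

section \<open>Square integrable functions and almost everywhere limits\<close>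

lemma L2_spaceD:
  assumes "u \<in> L2_space M"
  shows "u \<in> borel_measurable M" "integrable M (\<lambda>x. (u x)\<^sup>2)"
  using assms by (auto simp: L2_space_def)

lemma L2_space_mult_integrable:
  assumes "u \<in> L2_space M" "v \<in> L2_space M"
  shows "integrable M (\<lambda>x. u x * v x)"
proof (rule Bochner_Integration.integrable_bound)
  note [measurable] = L2_spaceD(1)[OF assms(1)] L2_spaceD(1)[OF assms(2)]
  show "integrable M (\<lambda>x. (u x)\<^sup>2 + (v x)\<^sup>2)"
    using assms by (auto dest: L2_spaceD)
  show "(\<lambda>x. u x * v x) \<in> borel_measurable M" by measurable
  have "\<bar>a * b\<bar> \<le> a\<^sup>2 + b\<^sup>2" for a b :: real
  proof -
    have "2 * (\<bar>a\<bar> * \<bar>b\<bar>) \<le> a\<^sup>2 + b\<^sup>2"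
      using sum_squares_bound[of "\<bar>a\<bar>" "\<bar>b\<bar>"] by simp
    moreover have "0 \<le> \<bar>a\<bar> * \<bar>b\<bar>" by simp
    ultimately show ?thesis unfolding abs_mult by linarith
  qed
  then show "AE x in M. norm (u x * v x) \<le> norm ((u x)\<^sup>2 + (v x)\<^sup>2)"
    by (intro AE_I2) (simp add: abs_of_nonneg)
qed

lemma L2_space_lincomb:
  assumes "u \<in> L2_space M" "v \<in> L2_space M"
  shows "(\<lambda>x. a * u x + b * v x) \<in> L2_space M"
proof -
  note [measurable] = L2_spaceD(1)[OF assms(1)] L2_spaceD(1)[OF assms(2)]
  have "integrable M (\<lambda>x. a\<^sup>2 * (u x)\<^sup>2 + b\<^sup>2 * (v x)\<^sup>2 + 2 * a * b * (u x * v x))"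
    using assms by (intro Bochner_Integration.integrable_add integrable_mult_right
      L2_spaceD L2_space_mult_integrable)
  also have "(\<lambda>x. a\<^sup>2 * (u x)\<^sup>2 + b\<^sup>2 * (v x)\<^sup>2 + 2 * a * b * (u x * v x)) =
      (\<lambda>x. (a * u x + b * v x)\<^sup>2)"
    by (simp add: fun_eq_iff power2_eq_square algebra_simps)
  finally show ?thesis by (simp add: L2_space_def)
qed

lemma L2_space_diff:
  assumes "u \<in> L2_space M" "v \<in> L2_space M"
  shows "(\<lambda>x. u x - v x) \<in> L2_space M"
  using L2_space_lincomb[OF assms, of 1 "-1"] by simp

lemma L2_space_integrable:
  assumes "finite_measure M" "u \<in> L2_space M"
  shows "integrable M u"
proof -
  interpret finite_measure M by fact
  \<comment> \<open>Finiteness of the measure enters here: the constant 1 is square integrable, so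
    multiplying by it turns the product lemma into plain integrability.\<close>
  have "(\<lambda>x. 1) \<in> L2_space M" by (simp add: L2_space_def)
  from L2_space_mult_integrable[OF assms(2) this] show ?thesis by simp
qed

text \<open>A substitute for Cauchy-Schwarz with a free parameter: pointwise, the term
  \<open>d\<close> dominates where the function is at most \<open>d\<close> in absolute value, and
  the quadratic term dominates elsewhere. Choosing \<open>d\<close> small first, and then the
  integral of the square small against \<open>d\<close>, makes the whole bound small.\<close>

lemma integral_abs_le_square:
  assumes M: "finite_measure M" and u: "u \<in> L2_space M" and d: "0 < d"
  shows "(\<integral>x. \<bar>u x\<bar> \<partial>M) \<le> d * measure M (space M) + (\<integral>x. (u x)\<^sup>2 \<partial>M) / d"
proof -
  interpret finite_measure M by fact
  have "\<bar>a\<bar> \<le> d + a\<^sup>2 / d" for a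
  proof (cases "\<bar>a\<bar> \<le> d")
    case True
    then show ?thesis using d by (simp add: add_increasing2)
  next
    case False
    then have "d * \<bar>a\<bar> \<le> \<bar>a\<bar> * \<bar>a\<bar>" by (intro mult_right_mono) auto
    then have "\<bar>a\<bar> \<le> a\<^sup>2 / d" using d by (simp add: field_simps power2_eq_square)
    then show ?thesis using d by linarith
  qed
  then have "(\<integral>x. \<bar>u x\<bar> \<partial>M) \<le> (\<integral>x. d + (u x)\<^sup>2 / d \<partial>M)"
    using L2_space_integrable[OF M u] L2_spaceD[OF u] by (intro integral_mono) auto
  also have "\<dots> = d * measure M (space M) + (\<integral>x. (u x)\<^sup>2 \<partial>M) / d"
    using L2_spaceD[OF u] by (subst Bochner_Integration.integral_add) auto
  finally show ?thesis .
qed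

lemma L2_Cauchy_AE_convergent_subseq:
  fixes s :: "nat \<Rightarrow> 'a \<Rightarrow> real"
  assumes M: "finite_measure M" and s: "\<And>n. s n \<in> L2_space M"
    and C: "\<And>e. 0 < e \<Longrightarrow> \<exists>k. \<forall>i\<ge>k. \<forall>j\<ge>k. (\<integral>x. (s i x - s j x)\<^sup>2 \<partial>M) < e"
  obtains r u where "strict_mono r" "u \<in> borel_measurable M"
    "AE x in M. (\<lambda>n. s (r n) x) \<longlonglongrightarrow> u x"
proof -
  note [measurable] = L2_spaceD(1)[OF s]
  have "\<exists>k. \<forall>i\<ge>k. \<forall>j\<ge>k. (LINT x|M. norm (s i x - s j x)) < e" if e: "0 < e" for e
  proof -
    \<comment> \<open>The added 1 keeps \<open>p\<close> positive even if the measure is zero. With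
      \<open>d = e / (2 * p)\<close> the constant term of the bound is at most
      \<open>e / 2\<close>.\<close>
    define p where "p = measure M (space M) + 1"
    define d where "d = e / (2 * p)"
    have p: "0 < p" by (simp add: p_def add_nonneg_pos)
    have d: "0 < d" using e p by (simp add: d_def)
    have "d * p = e / 2" using p by (simp add: d_def)
    then have dM: "d * measure M (space M) \<le> e / 2" using d by (simp add: p_def algebra_simps)
    \<comment> \<open>After division by \<open>d\<close>, the threshold \<open>d * e / 2\<close>
      leaves less than \<open>e / 2\<close> for the quadratic term.\<close>
    obtain k where k: "\<And>i j. i \<ge> k \<Longrightarrow> j \<ge> k \<Longrightarrow> (\<integral>x. (s i x - s j x)\<^sup>2 \<partial>M) < d * e / 2"
      using C[of "d * e / 2"] d e by auto
    have "(LINT x|M. norm (s i x - s j x)) < e" if "i \<ge> k" "j \<ge> k" for i j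
    proof -
      have "(\<integral>x. (s i x - s j x)\<^sup>2 \<partial>M) / d < e / 2"
        using k[OF that] d by (simp add: field_simps)
      then show ?thesis
        using integral_abs_le_square[OF M L2_space_diff[OF s[of i] s[of j]] d] dM
        unfolding real_norm_def by linarith
    qed
    then show ?thesis by blast
  qed
  then obtain r where r: "strict_mono r" "AE x in M. Cauchy (\<lambda>i. s (r i) x)"
    using cauchy_L1_AE_cauchy_subseq[of M s] L2_space_integrable[OF M s] by metis
  define u where "u x = lim (\<lambda>n. s (r n) x)" for x
  show thesis
  proof (rule that[OF r(1)])
    show "u \<in> borel_measurable M" unfolding u_def by measurable
    show "AE x in M. (\<lambda>n. s (r n) x) \<longlonglongrightarrow> u x"
      using r(2) by eventually_elim (simp add: u_def Cauchy_convergent_iff convergent_LIMSEQ_iff)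
  qed
qed

section \<open>Minimization of uniformly convex functionals\<close>

text \<open>The constant \<open>c\<close> measures the gain from passing to a midpoint; near the
  infimum no gain is left, so the squared distance must be small. Since \<open>mid\<close> only asks
  for some \<open>w\<close> in \<open>S\<close>, no linear structure on \<open>S\<close> is assumed.
  The premise \<open>lsc\<close> joins closedness of \<open>S\<close> to lower semicontinuity,
  because an almost everywhere limit is not known in advance to lie in \<open>S\<close>.\<close>

lemma unique_minimizer_uniformly_convex:
  assumes M: "finite_measure M" and c: "0 < c"
    and S: "S \<noteq> {}" "S \<subseteq> L2_space M" and bdd: "bdd_below (K ` S)"
    and mid: "\<And>u v. u \<in> S \<Longrightarrow> v \<in> S \<Longrightarrow>
      \<exists>w\<in>S. K w \<le> (K u + K v) / 2 - c * (\<integral>x. (u x - v x)\<^sup>2 \<partial>M)"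
    and lsc: "\<And>s u b. (\<And>n. s n \<in> S) \<Longrightarrow> u \<in> borel_measurable M \<Longrightarrow>
      (AE x in M. (\<lambda>n. s n x) \<longlonglongrightarrow> u x) \<Longrightarrow> (\<lambda>n. K (s n)) \<longlonglongrightarrow> b \<Longrightarrow> u \<in> S \<and> K u \<le> b"
  shows "\<exists>u. is_minimizer_on K S u \<and> (\<forall>w. is_minimizer_on K S w \<longrightarrow> (AE x in M. w x = u x))"
proof -
  define m where "m = Inf (K ` S)"
  have m: "m \<le> K u" if "u \<in> S" for u
    unfolding m_def using that bdd by (intro cInf_lower) auto
  \<comment> \<open>The element supplied by \<open>mid\<close> still has value at least
    \<open>m\<close>, which bounds the gain by the excess of the average over the infimum.\<close>
  have gap: "c * (\<integral>x. (u x - v x)\<^sup>2 \<partial>M) \<le> (K u + K v) / 2 - m" if "u \<in> S" "v \<in> S" for u v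
    using mid[OF that] m by force
  have "\<exists>u\<in>S. K u < m + inverse (real (Suc n))" for n
    using cInf_lessD[of "K ` S" "m + inverse (real (Suc n))"] S(1) by (auto simp: m_def)
  then obtain s where s: "\<And>n. s n \<in> S" "\<And>n. K (s n) < m + inverse (real (Suc n))"
    by metis
  have lim0: "(\<lambda>n. m + inverse (real (Suc n))) \<longlonglongrightarrow> m + 0"
    by (intro tendsto_add tendsto_const LIMSEQ_inverse_real_of_nat)
  have lim: "(\<lambda>n. K (s n)) \<longlonglongrightarrow> m"
    by (rule tendsto_sandwich[OF _ _ tendsto_const lim0[simplified]])
       (use m s in \<open>auto intro!: always_eventually less_imp_le\<close>)
  have cauchy: "\<exists>k. \<forall>i\<ge>k. \<forall>j\<ge>k. (\<integral>x. (s i x - s j x)\<^sup>2 \<partial>M) < e" if e: "0 < e" for e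
  proof -
    \<comment> \<open>Two values below \<open>m + c * e\<close> have an average exceeding
      \<open>m\<close> by less than \<open>c * e\<close>, so \<open>gap\<close> yields the bound
      \<open>e\<close> after cancelling \<open>c\<close>.\<close>
    have "eventually (\<lambda>n. K (s n) < m + c * e) sequentially"
      using order_tendstoD(2)[OF lim, of "m + c * e"] c e by simp
    then obtain k where k: "\<And>n. n \<ge> k \<Longrightarrow> K (s n) < m + c * e"
      by (auto simp: eventually_sequentially)
    have "(\<integral>x. (s i x - s j x)\<^sup>2 \<partial>M) < e" if "i \<ge> k" "j \<ge> k" for i j
    proof -
      have "c * (\<integral>x. (s i x - s j x)\<^sup>2 \<partial>M) < c * e"
        using gap[OF s(1) s(1), of i j] k[OF that(1)] k[OF that(2)] by argo
      then show ?thesis using c by simp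
    qed
    then show ?thesis by blast
  qed
  have "s n \<in> L2_space M" for n using s(1) S(2) by blast
  then obtain r u where r: "strict_mono r" "u \<in> borel_measurable M"
      "AE x in M. (\<lambda>n. s (r n) x) \<longlonglongrightarrow> u x"
    using L2_Cauchy_AE_convergent_subseq[OF M _ cauchy] by blast
  have u: "u \<in> S \<and> K u \<le> m"
    by (rule lsc[OF s(1) r(2,3)]) (rule LIMSEQ_subseq_LIMSEQ[OF lim r(1), unfolded o_def])
  show ?thesis
  proof (intro exI conjI allI impI)
    show "is_minimizer_on K S u"
      using u m by (auto simp: is_minimizer_on_def intro: order_trans)
    fix w assume "is_minimizer_on K S w"
    then have w: "w \<in> S" "K w \<le> K u" using u by (auto simp: is_minimizer_on_def)
    have d: "(\<lambda>x. w x - u x) \<in> L2_space M" using w u S(2) by (blast intro: L2_space_diff)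
    \<comment> \<open>Both values are at most \<open>m\<close>, so the right-hand side of
      \<open>gap\<close> is nonpositive.\<close>
    have "c * (\<integral>x. (w x - u x)\<^sup>2 \<partial>M) \<le> 0" using gap[OF w(1), of u] w u by argo
    then have "(\<integral>x. (w x - u x)\<^sup>2 \<partial>M) \<le> 0" using c by (simp add: mult_le_0_iff)
    then have "(\<integral>x. (w x - u x)\<^sup>2 \<partial>M) = 0" by (simp add: antisym)
    then have "AE x in M. (w x - u x)\<^sup>2 = 0"
      using L2_spaceD[OF d] by (subst (asm) integral_nonneg_eq_0_iff_AE) auto
    then show "AE x in M. w x = u x" by eventually_elim simp
  qed
qed

section \<open>Pointwise convexity and tools for Fatou's lemma\<close>

lemma difference_quotient_nonneg: "0 \<le> difference_quotient \<alpha> u x y"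
  by (simp add: difference_quotient_def)

lemma difference_quotient_midpoint_le:
  "difference_quotient \<alpha> (\<lambda>x. (u x + v x) / 2) x y \<le>
    (difference_quotient \<alpha> u x y + difference_quotient \<alpha> v x y) / 2"
proof (cases "x = y")
  case False
  define p where "p = \<bar>x - y\<bar> powr (1 + 2 * \<alpha>)"
  \<comment> \<open>The right side minus the left side is a quarter of the square of
    \<open>(a - c) - (b - d)\<close>.\<close>
  have "((a + b) / 2 - (c + d) / 2)\<^sup>2 \<le> ((a - c)\<^sup>2 + (b - d)\<^sup>2) / 2" for a b c d :: real
    using zero_le_power2[of "(a - c) - (b - d)"] by (simp add: power2_eq_square field_simps)
  then have "((u x + v x) / 2 - (u y + v y) / 2)\<^sup>2 / p \<le> ((u x - u y)\<^sup>2 + (v x - v y)\<^sup>2) / 2 / p"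
    by (intro divide_right_mono) (auto simp: p_def)
  then show ?thesis using False
    by (simp add: difference_quotient_def p_def add_divide_distrib mult.commute)
qed (simp add: difference_quotient_def)

text \<open>A null set stays null as a cylinder in either factor of the product. This carries almost
  everywhere convergence of functions over to their difference quotients, which live on pairs of
  points.\<close>

lemma AE_fst_snd:
  assumes M: "sigma_finite_measure M" and P: "AE x in M. P x"
  shows "AE z in M \<Otimes>\<^sub>M M. P (fst z) \<and> P (snd z)"
proof -
  interpret pair_sigma_finite M M using M by (simp add: pair_sigma_finite_def)
  obtain N where N: "\<And>x. x \<in> space M - N \<Longrightarrow> P x" "N \<in> null_sets M"
    using AE_E3[OF P] by blast
  have [measurable]: "N \<in> sets M" using N by auto
  have notN: "AE x in M. x \<notin> N" using N(2) by (rule AE_not_in)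
  have "AE z in M \<Otimes>\<^sub>M M. fst z \<notin> N \<and> snd z \<notin> N"
    by (rule AE_pair_measure) (use notN in \<open>measurable, auto\<close>)
  moreover have "AE z in M \<Otimes>\<^sub>M M. fst z \<in> space M \<and> snd z \<in> space M"
    by (rule AE_I2) (auto simp: space_pair_measure)
  ultimately show ?thesis by eventually_elim (auto intro: N)
qed

text \<open>Continuity of \<open>ennreal\<close>, which sends negative reals to 0, identifies the
  pointwise limit with the pointwise liminf almost everywhere; Fatou's lemma then applies.\<close>

lemma nn_integral_Fatou_AE:
  fixes h :: "nat \<Rightarrow> 'a \<Rightarrow> real"
  assumes [measurable]: "\<And>n. h n \<in> borel_measurable M"
    and "AE x in M. (\<lambda>n. h n x) \<longlonglongrightarrow> g x"
  shows "(\<integral>\<^sup>+x. ennreal (g x) \<partial>M) \<le> liminf (\<lambda>n. \<integral>\<^sup>+x. ennreal (h n x) \<partial>M)"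
proof -
  have "AE x in M. ennreal (g x) = liminf (\<lambda>n. ennreal (h n x))"
    using assms(2) by eventually_elim (auto intro!: lim_imp_Liminf[symmetric] tendsto_ennrealI)
  then have "(\<integral>\<^sup>+x. ennreal (g x) \<partial>M) = (\<integral>\<^sup>+x. liminf (\<lambda>n. ennreal (h n x)) \<partial>M)"
    by (rule nn_integral_cong_AE)
  also have "\<dots> \<le> liminf (\<lambda>n. \<integral>\<^sup>+x. ennreal (h n x) \<partial>M)"
    by (rule nn_integral_liminf) simp
  finally show ?thesis .
qed

text \<open>The tail infima increase, so the sum of their suprema is the supremum of their sums, and
  a sum of infima is at most the infimum of the sums.\<close>

lemma ennreal_liminf_add_le:
  fixes a b :: "nat \<Rightarrow> ennreal"
  shows "liminf a + liminf b \<le> liminf (\<lambda>n. a n + b n)"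
proof -
  have inc: "incseq (\<lambda>n. INF m\<in>{n..}. t m)" for t :: "nat \<Rightarrow> ennreal"
    by (auto simp: incseq_def intro: INF_superset_mono)
  have "liminf a + liminf b = (SUP n. (INF m\<in>{n..}. a m) + (INF m\<in>{n..}. b m))"
    unfolding liminf_SUP_INF by (rule ennreal_SUP_add[symmetric, OF inc inc])
  also have "\<dots> \<le> liminf (\<lambda>n. a n + b n)"
    unfolding liminf_SUP_INF
    by (intro SUP_mono' INF_greatest add_mono) (auto intro: INF_lower)
  finally show ?thesis .
qed

section \<open>The hybrid energy: membership, convexity and lower semicontinuity\<close>

text \<open>The integrand is nonnegative, so discarding the atoms in each variable can only lower
  the double integral.\<close>

lemma gagliardo_sq_le_hybrid_energy:
  assumes [measurable]: "u \<in> borel_measurable (hybrid_measure N)"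
  shows "gagliardo_sq \<alpha> u \<le> hybrid_energy N \<alpha> u"
proof -
  let ?M = "hybrid_measure N" and ?Q = "\<lambda>x y. ennreal (difference_quotient \<alpha> u x y)"
  interpret finite_measure ?M by (rule finite_measure_hybrid)
  have Q [measurable]: "(\<lambda>z. ?Q (fst z) (snd z)) \<in> borel_measurable (?M \<Otimes>\<^sub>M ?M)"
    by measurable
  have Qx: "(\<lambda>y. ?Q x y) \<in> borel_measurable ?M" if "x \<in> hybrid_set N" for x
    using measurable_compose[OF measurable_Pair1' Q, of x] that by simp
  have Qi: "(\<lambda>x. \<integral>\<^sup>+y. ?Q x y \<partial>?M) \<in> borel_measurable ?M"
    by (rule borel_measurable_nn_integral) (simp add: split_beta')
  have "gagliardo_sq \<alpha> u \<le> (\<integral>\<^sup>+x. (\<integral>\<^sup>+y. ?Q x y \<partial>?M) \<partial>unit_measure)"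
    unfolding gagliardo_sq_def
    by (intro nn_integral_mono)
       (subst nn_integral_hybrid[OF Qx], auto simp: space_restrict_space hybrid_set_def)
  also have "\<dots> \<le> (\<integral>\<^sup>+x. (\<integral>\<^sup>+y. ?Q x y \<partial>?M) \<partial>?M)"
    by (subst nn_integral_hybrid[OF Qi]) simp
  also have "\<dots> = hybrid_energy N \<alpha> u"
    unfolding hybrid_energy_def by (subst nn_integral_fst[OF Q, symmetric]) simp
  finally show ?thesis .
qed

text \<open>A membership test through integrals over the whole hybrid measure, which are the
  quantities that convexity and Fatou's lemma control.\<close>

lemma hybrid_spaceI:
  assumes u: "u \<in> borel_measurable (hybrid_measure N)"
    and sq: "(\<integral>\<^sup>+x. ennreal ((u x)\<^sup>2) \<partial>hybrid_measure N) < \<infinity>"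
    and en: "hybrid_energy N \<alpha> u < \<infinity>"
  shows "u \<in> hybrid_space N \<alpha>"
proof -
  have "{0<..<1} \<subseteq> hybrid_set N" by (auto simp: hybrid_set_def)
  moreover have "u \<in> borel_measurable (restrict_space borel (hybrid_set N))"
    using u by (simp add: measurable_cong_sets[OF sets_hybrid_measure refl])
  ultimately have "u \<in> borel_measurable (restrict_space borel {0<..<1})"
    by (rule measurable_restrict_mono[rotated])
  then have um: "u \<in> borel_measurable unit_measure"
    by (simp add: measurable_cong_sets[OF sets_restrict_space_cong[OF sets_lborel] refl])
  have "(\<integral>\<^sup>+x. ennreal ((u x)\<^sup>2) \<partial>unit_measure) < \<infinity>"
    using sq u by (subst (asm) nn_integral_hybrid) auto
  then have "u \<in> L2_space unit_measure"
    using um by (simp add: L2_space_def integrable_iff_bounded)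
  then show ?thesis
    using u en gagliardo_sq_le_hybrid_energy[OF u, of \<alpha>]
    by (simp add: hybrid_space_def frac_sobolev_def)
qed

text \<open>The pointwise convexity bound is integrated. The factor 2 on the left avoids halving in
  \<open>ennreal\<close>.\<close>

lemma hybrid_energy_midpoint_le:
  assumes [measurable]: "u \<in> borel_measurable (hybrid_measure N)" "v \<in> borel_measurable (hybrid_measure N)"
  shows "2 * hybrid_energy N \<alpha> (\<lambda>x. (u x + v x) / 2) \<le>
    hybrid_energy N \<alpha> u + hybrid_energy N \<alpha> v"
proof -
  let ?P = "hybrid_measure N \<Otimes>\<^sub>M hybrid_measure N"
  have "2 * ennreal (difference_quotient \<alpha> (\<lambda>x. (u x + v x) / 2) x y) \<le>
      ennreal (difference_quotient \<alpha> u x y) + ennreal (difference_quotient \<alpha> v x y)" for x y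
  proof -
    have "2 * ennreal (difference_quotient \<alpha> (\<lambda>x. (u x + v x) / 2) x y) =
        ennreal (2 * difference_quotient \<alpha> (\<lambda>x. (u x + v x) / 2) x y)"
      by (simp add: ennreal_mult difference_quotient_nonneg)
    also have "\<dots> \<le> ennreal (difference_quotient \<alpha> u x y + difference_quotient \<alpha> v x y)"
      using difference_quotient_midpoint_le[of \<alpha> u v x y] by (intro ennreal_leI) simp
    finally show ?thesis by (simp add: difference_quotient_nonneg)
  qed
  then have "(\<integral>\<^sup>+z. 2 * ennreal (difference_quotient \<alpha> (\<lambda>x. (u x + v x) / 2) (fst z) (snd z)) \<partial>?P) \<le>
      (\<integral>\<^sup>+z. ennreal (difference_quotient \<alpha> u (fst z) (snd z)) +
        ennreal (difference_quotient \<alpha> v (fst z) (snd z)) \<partial>?P)"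
    by (intro nn_integral_mono)
  then show ?thesis
    unfolding hybrid_energy_def by (simp add: nn_integral_cmult nn_integral_add)
qed

text \<open>The \<open>ennreal\<close> bound does two jobs: it makes the energy of the midpoint
  finite, hence the midpoint a member, and once all three energies are finite it passes to real
  numbers.\<close>

lemma hybrid_space_midpoint:
  assumes u: "u \<in> hybrid_space N \<alpha>" and v: "v \<in> hybrid_space N \<alpha>" and \<alpha>: "0 < \<alpha>"
  shows "(\<lambda>x. (u x + v x) / 2) \<in> hybrid_space N \<alpha>"
    and "enn2real (hybrid_energy N \<alpha> (\<lambda>x. (u x + v x) / 2)) \<le>
      (enn2real (hybrid_energy N \<alpha> u) + enn2real (hybrid_energy N \<alpha> v)) / 2"
proof -
  let ?w = "\<lambda>x. (u x + v x) / 2"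
  have L: "?w \<in> L2_space (hybrid_measure N)"
    using L2_space_lincomb[OF hybrid_space_L2[OF u] hybrid_space_L2[OF v], of "1/2" "1/2"]
    by (simp add: add_divide_distrib)
  note m = L2_spaceD(1)[OF hybrid_space_L2[OF u]] L2_spaceD(1)[OF hybrid_space_L2[OF v]]
  obtain a b where ab: "hybrid_energy N \<alpha> u = ennreal a" "hybrid_energy N \<alpha> v = ennreal b" "0 \<le> a" "0 \<le> b"
    using hybrid_energy_finite[OF u \<alpha>] hybrid_energy_finite[OF v \<alpha>]
    by (metis less_top_ennreal infinity_ennreal_def)
  have le: "2 * hybrid_energy N \<alpha> ?w \<le> ennreal (a + b)"
    using hybrid_energy_midpoint_le[OF m, of \<alpha>] ab by simp
  have fin: "hybrid_energy N \<alpha> ?w < \<infinity>"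
    using le_less_trans[OF le ennreal_less_top] by (auto simp: ennreal_mult_less_top)
  then obtain c where c: "hybrid_energy N \<alpha> ?w = ennreal c" "0 \<le> c"
    by (metis less_top_ennreal infinity_ennreal_def)
  have "ennreal (2 * c) \<le> ennreal (a + b)"
    using le c by (simp add: ennreal_mult)
  then have "2 * c \<le> a + b" using ab by (simp add: ennreal_le_iff del: ennreal_plus)
  then show "enn2real (hybrid_energy N \<alpha> ?w) \<le>
      (enn2real (hybrid_energy N \<alpha> u) + enn2real (hybrid_energy N \<alpha> v)) / 2"
    using ab c by simp
  show "?w \<in> hybrid_space N \<alpha>"
    using L fin by (intro hybrid_spaceI) (auto simp: L2_space_def integrable_iff_bounded)
qed

lemma hybrid_energy_liminf:
  assumes s: "\<And>n. s n \<in> borel_measurable (hybrid_measure N)"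
    and lim: "AE x in hybrid_measure N. (\<lambda>n. s n x) \<longlonglongrightarrow> u x"
  shows "hybrid_energy N \<alpha> u \<le> liminf (\<lambda>n. hybrid_energy N \<alpha> (s n))"
proof -
  interpret finite_measure "hybrid_measure N" by (rule finite_measure_hybrid)
  have "AE z in hybrid_measure N \<Otimes>\<^sub>M hybrid_measure N.
      (\<lambda>n. s n (fst z)) \<longlonglongrightarrow> u (fst z) \<and> (\<lambda>n. s n (snd z)) \<longlonglongrightarrow> u (snd z)"
    using AE_fst_snd[OF _ lim] sigma_finite_measure_axioms by simp
  then have "AE z in hybrid_measure N \<Otimes>\<^sub>M hybrid_measure N.
      (\<lambda>n. difference_quotient \<alpha> (s n) (fst z) (snd z)) \<longlonglongrightarrow>
        difference_quotient \<alpha> u (fst z) (snd z)"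
    by eventually_elim (auto simp: difference_quotient_def intro!: tendsto_intros)
  then show ?thesis
    unfolding hybrid_energy_def using s by (intro nn_integral_Fatou_AE) auto
qed

section \<open>The functional as a sum of nonnegative terms\<close>

text \<open>The linear term has no sign; here it is absorbed into a square, at the price of a
  constant independent of \<open>u\<close>. This gives the lower bound of the functional and makes
  Fatou's lemma applicable.\<close>

lemma hybrid_functional_complete_square:
  assumes l: "0 < l" and f: "f \<in> L2_space (hybrid_measure N)" and u: "u \<in> hybrid_space N \<alpha>"
  shows "hybrid_functional N \<alpha> l f u =
    (enn2real (hybrid_energy N \<alpha> u) + l * (\<integral>x. (u x - f x / l)\<^sup>2 \<partial>hybrid_measure N)
      - (\<integral>x. (f x)\<^sup>2 \<partial>hybrid_measure N) / l) / 2"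
proof -
  let ?M = "hybrid_measure N"
  note u = hybrid_space_L2[OF u]
  note i = L2_spaceD(2)[OF u] L2_spaceD(2)[OF f] L2_space_mult_integrable[OF f u]
  have "(u x - f x / l)\<^sup>2 = (u x)\<^sup>2 + (f x)\<^sup>2 / l\<^sup>2 - 2 / l * (f x * u x)" for x
    using l by (simp add: power2_eq_square field_simps)
  then have "(\<integral>x. (u x - f x / l)\<^sup>2 \<partial>?M) =
      (\<integral>x. (u x)\<^sup>2 + (f x)\<^sup>2 / l\<^sup>2 - 2 / l * (f x * u x) \<partial>?M)" by simp
  also have "\<dots> = (\<integral>x. (u x)\<^sup>2 \<partial>?M) + (\<integral>x. (f x)\<^sup>2 \<partial>?M) / l\<^sup>2 - 2 / l * (\<integral>x. f x * u x \<partial>?M)"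
    using i by simp
  finally show ?thesis
    using l by (simp add: hybrid_functional_def L2_norm_def power2_eq_square field_simps)
qed

text \<open>The parallelogram identity for \<open>u - g\<close> and \<open>v - g\<close>, in which
  \<open>g\<close> cancels from the difference.\<close>

lemma integral_square_midpoint:
  assumes u: "u \<in> L2_space M" and v: "v \<in> L2_space M" and g: "g \<in> L2_space M"
  shows "(\<integral>x. ((u x + v x) / 2 - g x)\<^sup>2 \<partial>M) =
    ((\<integral>x. (u x - g x)\<^sup>2 \<partial>M) + (\<integral>x. (v x - g x)\<^sup>2 \<partial>M)) / 2 - (\<integral>x. (u x - v x)\<^sup>2 \<partial>M) / 4"
proof -
  note i = L2_spaceD(2)[OF L2_space_diff[OF u g]] L2_spaceD(2)[OF L2_space_diff[OF v g]]
    L2_spaceD(2)[OF L2_space_diff[OF u v]]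
  have "((u x + v x) / 2 - g x)\<^sup>2 = ((u x - g x)\<^sup>2 + (v x - g x)\<^sup>2) / 2 - (u x - v x)\<^sup>2 / 4" for x
    by (simp add: power2_eq_square field_simps)
  then show ?thesis using i by simp
qed

lemma hybrid_functional_lower_semicontinuous:
  assumes \<alpha>: "0 < \<alpha>" and l: "0 < l" and f: "f \<in> L2_space (hybrid_measure N)"
    and s: "\<And>n. s n \<in> hybrid_space N \<alpha>" and u: "u \<in> borel_measurable (hybrid_measure N)"
    and ae: "AE x in hybrid_measure N. (\<lambda>n. s n x) \<longlonglongrightarrow> u x"
    and lim: "(\<lambda>n. hybrid_functional N \<alpha> l f (s n)) \<longlonglongrightarrow> b"
  shows "u \<in> hybrid_space N \<alpha> \<and> hybrid_functional N \<alpha> l f u \<le> b"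
proof -
  let ?M = "hybrid_measure N" and ?E = "hybrid_energy N \<alpha>"
  define C where "C = (\<integral>x. (f x)\<^sup>2 \<partial>?M) / l"
  define g where "g x = f x / l" for x
  have g: "g \<in> L2_space ?M"
    using L2_space_lincomb[OF f f, of "1 / l" 0] by (simp add: g_def [abs_def])
  note [measurable] = u L2_spaceD(1)[OF hybrid_space_L2[OF s]] L2_spaceD(1)[OF g]
  note sg = L2_spaceD(2)[OF L2_space_diff[OF hybrid_space_L2[OF s] g]]
  \<comment> \<open>A nonnegative integral is used because the limit \<open>u\<close> is not yet
    known to be square integrable: a Bochner integral would default to 0 in the divergent case and
    hide it.\<close>
  define D where "D w = (\<integral>\<^sup>+x. ennreal (l * (w x - g x)\<^sup>2) \<partial>?M)" for w
  have D_eq: "D w = ennreal (l * (\<integral>x. (w x - g x)\<^sup>2 \<partial>?M))"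
    if "integrable ?M (\<lambda>x. (w x - g x)\<^sup>2)" for w
    using that l unfolding D_def
    by (subst nn_integral_eq_integral) auto
  have J: "hybrid_functional N \<alpha> l f w =
      (enn2real (?E w) + l * (\<integral>x. (w x - g x)\<^sup>2 \<partial>?M) - C) / 2" if "w \<in> hybrid_space N \<alpha>" for w
    using hybrid_functional_complete_square[OF l f that] by (simp add: g_def C_def)
  \<comment> \<open>Fatou's lemma bounds \<open>?E\<close> and \<open>D\<close> separately, but only
    their sum is known to converge; this equation supplies its limit.\<close>
  have ED: "?E (s n) + D (s n) = ennreal (2 * hybrid_functional N \<alpha> l f (s n) + C)" for n
  proof -
    obtain e where e: "?E (s n) = ennreal e" "0 \<le> e"
      using hybrid_energy_finite[OF s \<alpha>, of n] by (metis less_top_ennreal infinity_ennreal_def)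
    have "2 * hybrid_functional N \<alpha> l f (s n) + C = e + l * (\<integral>x. (s n x - g x)\<^sup>2 \<partial>?M)"
      using e by (simp add: J[OF s] field_simps)
    then show ?thesis using l e by (simp add: D_eq[OF sg])
  qed
  have "D u \<le> liminf (\<lambda>n. D (s n))"
    unfolding D_def
  proof (rule nn_integral_Fatou_AE)
    show "AE x in ?M. (\<lambda>n. l * (s n x - g x)\<^sup>2) \<longlonglongrightarrow> l * (u x - g x)\<^sup>2"
      using ae by eventually_elim (auto intro!: tendsto_intros)
  qed measurable
  moreover have "?E u \<le> liminf (\<lambda>n. ?E (s n))"
    by (rule hybrid_energy_liminf[OF _ ae]) measurable
  ultimately have "?E u + D u \<le> liminf (\<lambda>n. ?E (s n)) + liminf (\<lambda>n. D (s n))"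
    by (rule add_mono[rotated])
  also have "\<dots> \<le> liminf (\<lambda>n. ?E (s n) + D (s n))" by (rule ennreal_liminf_add_le)
  also have "\<dots> = ennreal (2 * b + C)"
    unfolding ED using lim by (intro lim_imp_Liminf tendsto_ennrealI tendsto_intros) auto
  finally have le: "?E u + D u \<le> ennreal (2 * b + C)" .
  have fin: "?E u < \<infinity>" "D u < \<infinity>"
    using le_less_trans[OF le ennreal_less_top] by auto
  have Dl: "D u = ennreal l * (\<integral>\<^sup>+x. ennreal ((u x - g x)\<^sup>2) \<partial>?M)"
    unfolding D_def using l by (simp add: ennreal_mult nn_integral_cmult)
  have "(\<lambda>x. u x - g x) \<in> L2_space ?M"
    using fin(2) l unfolding Dl by (auto simp: L2_space_def integrable_iff_bounded ennreal_mult_less_top)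
  \<comment> \<open>Adding \<open>g\<close> back to \<open>u - g\<close> recovers
    \<open>u\<close>.\<close>
  from L2_space_lincomb[OF this g, of 1 1] have uL: "u \<in> L2_space ?M" by simp
  then have uH: "u \<in> hybrid_space N \<alpha>"
    using fin(1) by (intro hybrid_spaceI) (auto simp: L2_space_def integrable_iff_bounded)
  obtain e where e: "?E u = ennreal e" "0 \<le> e"
    using fin(1) by (metis less_top_ennreal infinity_ennreal_def)
  have d: "0 \<le> l * (\<integral>x. (u x - g x)\<^sup>2 \<partial>?M)" using l by simp
  have "ennreal (e + l * (\<integral>x. (u x - g x)\<^sup>2 \<partial>?M)) \<le> ennreal (2 * b + C)"
    using le e d unfolding D_eq[OF L2_spaceD(2)[OF L2_space_diff[OF uL g]]] by simp
  \<comment> \<open>Since \<open>ennreal\<close> sends negative reals to 0, the inequality descends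
    to the reals only once its right-hand side is known to be nonnegative. That sign comes from the
    sequence, where the expression is an energy plus a weighted squared distance.\<close>
  moreover have "0 \<le> 2 * b + C"
  proof (rule LIMSEQ_le_const)
    show "(\<lambda>n. 2 * hybrid_functional N \<alpha> l f (s n) + C) \<longlonglongrightarrow> 2 * b + C"
      using lim by (intro tendsto_intros)
    show "\<exists>k. \<forall>n\<ge>k. 0 \<le> 2 * hybrid_functional N \<alpha> l f (s n) + C"
    proof (intro exI allI impI)
      show "0 \<le> 2 * hybrid_functional N \<alpha> l f (s n) + C" for n
        using l by (simp add: J[OF s] add_divide_distrib diff_divide_distrib)
    qed
  qed
  ultimately have "e + l * (\<integral>x. (u x - g x)\<^sup>2 \<partial>?M) \<le> 2 * b + C"
    using ennreal_le_iff by blast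
  then show ?thesis using uH e by (simp add: J[OF uH])
qed

theorem theorem3p2:
  fixes N :: nat and \<alpha> l :: real and f :: "real \<Rightarrow> real"
  assumes "2 \<le> N" and "0 < \<alpha>" and "\<alpha> < 1" and "0 < l"
    and "f \<in> L2_space (hybrid_measure N)"
  shows "\<exists>u. is_minimizer_on (hybrid_functional N \<alpha> l f) (hybrid_space N \<alpha>) u \<and>
    (\<forall>w. is_minimizer_on (hybrid_functional N \<alpha> l f) (hybrid_space N \<alpha>) w \<longrightarrow>
      (AE x in hybrid_measure N. w x = u x))"
\<comment> \<open>The modulus is the coefficient \<open>l / 2\<close> of the square in the
  functional times the \<open>1 / 4\<close> of the parallelogram identity.\<close>
proof (rule unique_minimizer_uniformly_convex[where c = "l / 8"])
  let ?M = "hybrid_measure N" and ?J = "hybrid_functional N \<alpha> l f"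
  note J = hybrid_functional_complete_square[OF assms(4,5)]
  show "finite_measure ?M" by (rule finite_measure_hybrid)
  show "0 < l / 8" using assms by simp
  show "hybrid_space N \<alpha> \<subseteq> L2_space ?M" using hybrid_space_L2 by blast
  have "difference_quotient \<alpha> (\<lambda>x. 0) x y = 0" for x y
    by (simp add: difference_quotient_def)
  then have "(\<lambda>x. 0) \<in> hybrid_space N \<alpha>"
    by (intro hybrid_spaceI) (auto simp: hybrid_energy_def)
  then show "hybrid_space N \<alpha> \<noteq> {}" by blast
  \<comment> \<open>The bound is the constant left by completing the square, the two other terms
    being nonnegative.\<close>
  show "bdd_below (?J ` hybrid_space N \<alpha>)"
    by (rule bdd_belowI2[of _ "- (\<integral>x. (f x)\<^sup>2 \<partial>?M) / l / 2"]) (use assms in \<open>simp add: J\<close>)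
  fix u v assume u: "u \<in> hybrid_space N \<alpha>" and v: "v \<in> hybrid_space N \<alpha>"
  have g: "(\<lambda>x. f x / l) \<in> L2_space ?M"
    using L2_space_lincomb[OF assms(5,5), of "1 / l" 0] by simp
  note mid = hybrid_space_midpoint[OF u v assms(2)]
  show "\<exists>w\<in>hybrid_space N \<alpha>. ?J w \<le> (?J u + ?J v) / 2 - l / 8 * (\<integral>x. (u x - v x)\<^sup>2 \<partial>?M)"
  proof (rule bexI[OF _ mid(1)])
    \<comment> \<open>Here \<open>A\<close> stands for the energy of the midpoint, \<open>B\<close>
      and \<open>B'\<close> for those of \<open>u\<close> and \<open>v\<close>, \<open>P\<close> and
      \<open>Q\<close> for their squared distances to \<open>f / l\<close>, \<open>R\<close> for the
      squared distance between them, and \<open>C\<close> for the constant.\<close>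
    have convex: "(A + l * ((P + Q) / 2 - R / 4) - C) / 2 \<le>
        ((B + l * P - C) / 2 + (B' + l * Q - C) / 2) / 2 - l / 8 * R"
      if "A \<le> (B + B') / 2" for A B B' P Q R C :: real
      using that by (simp add: field_simps)
    show "?J (\<lambda>x. (u x + v x) / 2) \<le> (?J u + ?J v) / 2 - l / 8 * (\<integral>x. (u x - v x)\<^sup>2 \<partial>?M)"
      unfolding J[OF mid(1)] J[OF u] J[OF v]
        integral_square_midpoint[OF hybrid_space_L2[OF u] hybrid_space_L2[OF v] g]
      by (rule convex[OF mid(2)])
  qed
qed (rule hybrid_functional_lower_semicontinuous[OF assms(2,4,5)])

end
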